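(* Let $G$ be a finite simple graph and let $q\ge 0$ be an integer. If $A\in\mathcal{S}(G)$ has exactly $q$ negative eigenvalues (counted with multiplicity), then the nullity of $A$ is at most $Z_q(G)$.
   Context: For a finite simple graph $G$ on vertex set $V=\{1,\dots,n\}$, $\mathcal{S}(G)$ denotes the set of all $n\times n$ Hermitian (complex) matrices $A$ such that for $i\ne j$, $a_{ij}\ne 0$ if and only if $ij$ is an edge of $G$; diagonal entries are unrestricted. For $W\subseteq V$, $G[W]$ is the induced subgraph on $W$. Color change rule on a graph $H$ whose vertices are colored black and white: if a black vertex of $H$ has exactly one white neighbor in $H$, that white neighbor is recolored black. "Applying the color change rule" on $H$ means performing such recolorings. The $Z_q$-forcing game on $G$: initially all vertices are white. There are two players, Black (who spends tokens) and White. Until all vertices are black, Black repeatedly chooses one of the following moves: (1) recolor any single white vertex black at the cost of one token; (2) apply the color change rule on the whole graph $G$, at no cost; (3) letting $B$ be the set of currently black vertices and $W_1,\dots,W_k$ the vertex sets of the connected components of $G[V\setminus B]$, Black announces a set $S$ of at least $q+1$ of these components; White then chooses a nonempty subset $T=\{W_{i_1},\dots,W_{i_\ell}\}\subseteq S$ and announces it; Black then applies the color change rule on the induced subgraph $G[B\cup W_{i_1}\cup\dots\cup W_{i_\ell}]$, at no cost. White plays to maximize the number of tokens Black spends. $Z_q(G)$ is the minimum number of tokens Black must spend to make all vertices black, regardless of White's play (i.e., the value of this game for Black, over adaptive strategies). *)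

theory Defs
  imports
    "Jordan_Normal_Form.Matrix_Kernel"
    "Jordan_Normal_Form.Char_Poly"
    "Jordan_Normal_Form.Schur_Decomposition"
begin

text \<open>
  A graph is given by its vertex set and the set of ordered pairs of adjacent vertices, so an
  undirected edge occurs in both orientations. Vertices are numbered from 0, like the row and
  column indices of matrices. The induced subgraph on \<open>U\<close> has edge set \<open>Restr E U\<close>.
\<close>

definition simple_graph :: "nat \<Rightarrow> (nat \<times> nat) set \<Rightarrow> bool" where
  "simple_graph n E \<longleftrightarrow> E \<subseteq> {0..<n} \<times> {0..<n} \<and> sym E \<and> irrefl E"

definition hermitian_matrices_of_graph :: "nat \<Rightarrow> (nat \<times> nat) set \<Rightarrow> complex mat set" where
  "hermitian_matrices_of_graph n E =
     {A \<in> carrier_mat n n. mat_adjoint A = A \<and>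
        (\<forall>i<n. \<forall>j<n. i \<noteq> j \<longrightarrow> (A $$ (i, j) \<noteq> 0 \<longleftrightarrow> (i, j) \<in> E))}"

text \<open>
  The multiplicity is the algebraic one. The sum is finite for square \<open>A\<close>, since the
  characteristic polynomial is then nonzero.
\<close>

definition num_neg_eigenvalues :: "complex mat \<Rightarrow> nat" where
  "num_neg_eigenvalues A =
     (\<Sum>x | x < 0 \<and> eigenvalue A (complex_of_real x). order (complex_of_real x) (char_poly A))"

text \<open>
  For a symmetric edge set, the classes of the equivalence relation "joined by a path in the
  subgraph induced by \<open>U\<close>" are the vertex sets of its connected components.
\<close>

definition component_sets :: "('a \<times> 'a) set \<Rightarrow> 'a set \<Rightarrow> 'a set set" where
  "component_sets E U = U // (Restr E U)\<^sup>*"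

text \<open>
  One recoloring in the graph with edge set \<open>F\<close>; the sets are the black vertices before
  and after. Only the neighborhood of \<open>u\<close> in \<open>F\<close> matters, so black vertices outside the graph
  (which are isolated in \<open>F\<close>) play no role.
\<close>

inductive recolor :: "('a \<times> 'a) set \<Rightarrow> 'a set \<Rightarrow> 'a set \<Rightarrow> bool" for F where
  "u \<in> B \<Longrightarrow> F `` {u} - B = {w} \<Longrightarrow> recolor F B (insert w B)"

text \<open>
  \<open>black_can_finish q V E B k\<close>: from the position with black vertices \<open>B\<close>, Black has a strategy
  that, whatever White does, makes all vertices black after finitely many moves and spends at
  most \<open>k\<close> further tokens. Applying the color change rule means performing any number of
  recolorings one after another. In the last rule Black picks \<open>S\<close>, then White picks \<open>T\<close>, and
  Black recolors knowing \<open>T\<close>.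
\<close>

inductive black_can_finish ::
    "nat \<Rightarrow> 'a set \<Rightarrow> ('a \<times> 'a) set \<Rightarrow> 'a set \<Rightarrow> nat \<Rightarrow> bool" for q V E where
  all_black: "black_can_finish q V E V k"
| token: "v \<in> V - B \<Longrightarrow> black_can_finish q V E (insert v B) k \<Longrightarrow>
    black_can_finish q V E B (Suc k)"
| color_change: "(recolor E)\<^sup>*\<^sup>* B B' \<Longrightarrow> black_can_finish q V E B' k \<Longrightarrow>
    black_can_finish q V E B k"
| announce: "S \<subseteq> component_sets E (V - B) \<Longrightarrow> finite S \<Longrightarrow> card S \<ge> q + 1 \<Longrightarrow>
    (\<forall>T. T \<noteq> {} \<and> T \<subseteq> S \<longrightarrow>
       (\<exists>B'. (recolor (Restr E (B \<union> \<Union>T)))\<^sup>*\<^sup>* B B' \<and> black_can_finish q V E B' k)) \<Longrightarrow>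
    black_can_finish q V E B k"

definition Z_forcing_number :: "nat \<Rightarrow> 'a set \<Rightarrow> ('a \<times> 'a) set \<Rightarrow> nat" where
  "Z_forcing_number q V E = (LEAST k. black_can_finish q V E {} k)"

text \<open>The least number exists: Black can pay for every vertex.\<close>

lemma black_can_finish_card:
  assumes "finite V" "B \<subseteq> V"
  shows "black_can_finish q V E B (card (V - B))"
  using assms(2)
proof (induction "card (V - B)" arbitrary: B)
  case 0
  then have "B = V" using assms(1) by auto
  then show ?case by (simp add: black_can_finish.all_black)
next
  case (Suc k)
  then obtain v where v: "v \<in> V - B" by (metis card.empty ex_in_conv nat.distinct(1))
  then have "card (V - insert v B) = k"
    using Suc.hyps(2) assms(1) by (metis Diff_insert card_Diff_singleton diff_Suc_1)
  then have "black_can_finish q V E (insert v B) k"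
    using Suc.hyps(1) Suc.prems v by blast
  then show ?case using v Suc.hyps(2) by (metis black_can_finish.token)
qed

lemma black_can_finish_Z_forcing_number:
  "finite V \<Longrightarrow> black_can_finish q V E {} (Z_forcing_number q V E)"
  unfolding Z_forcing_number_def by (rule LeastI[where k = "card (V - {})"]) (rule black_can_finish_card, auto)

end

theory Submission
  imports Defs
begin

text \<open>
  By induction on Black's strategy with \<open>k\<close> tokens, the kernel vectors of \<open>A\<close> that vanish on the
  black vertices are determined by at most \<open>k\<close> of their coordinates. Tokens and the color change
  rule are immediate. When Black announces \<open>q + 1\<close> components, restrict a kernel vector \<open>x\<close> to
  each of them. The restrictions \<open>x\<^sub>W\<close> are mutually isotropic, because \<open>A x\<^sub>W\<close> is supported on the
  black vertices, and \<open>q + 1\<close> unknowns suffice to make a nontrivial combination \<open>z\<close> of them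
  orthogonal to the \<open>q\<close> negative eigenvectors; hence \<open>A z = 0\<close>. White answers with the set \<open>T\<close> of
  components occurring in \<open>z\<close>: every recoloring in the graph induced on the black vertices and
  \<open>T\<close> is valid for \<open>z\<close>, so \<open>x\<close> vanishes wherever Black recolors. The set \<open>T\<close> depends on \<open>x\<close>,
  but for \<open>x\<close> of maximal support it serves all the kernel vectors at once.
\<close>

section \<open>Unitary diagonalization of Hermitian matrices\<close>

lemma dim_mat_adjoint [simp]:
  "dim_row (mat_adjoint A) = dim_col A" "dim_col (mat_adjoint A) = dim_row A"
  by (auto simp: mat_adjoint_def mat_of_rows_def)

lemma mat_adjoint_carrier [simp]: "A \<in> carrier_mat n m \<Longrightarrow> mat_adjoint A \<in> carrier_mat m n"
  by (rule carrier_matI) auto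

lemma index_mat_adjoint [simp]:
  "i < dim_col A \<Longrightarrow> j < dim_row A \<Longrightarrow> mat_adjoint A $$ (i, j) = conjugate (A $$ (j, i))"
  by (auto simp: mat_adjoint_def mat_of_rows_index)

lemma mat_adjoint_mult:
  fixes A B :: "complex mat"
  assumes "A \<in> carrier_mat n m" "B \<in> carrier_mat m k"
  shows "mat_adjoint (A * B) = mat_adjoint B * mat_adjoint A"
  by (rule eq_matI) (use assms in \<open>auto simp: scalar_prod_def mult.commute intro!: sum.cong\<close>)

lemma mat_adjoint_adjoint [simp]: "mat_adjoint (mat_adjoint A) = A"
  by (rule eq_matI) auto

lemma mat_adjoint_one [simp]: "mat_adjoint (1\<^sub>m n :: complex mat) = 1\<^sub>m n"
  by (rule eq_matI) auto

text \<open>Extend \<open>v\<close> to a basis, orthogonalize it by Gram-Schmidt, which leaves the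
  first vector unchanged, and normalize. The scalar \<open>a\<close> absorbs the normalization of
  \<open>v\<close>.\<close>

lemma unitary_completion:
  fixes v :: "complex vec"
  assumes v: "v \<in> carrier_vec n" and v0: "v \<noteq> 0\<^sub>v n"
  obtains W a where "W \<in> carrier_mat n n" "mat_adjoint W * W = 1\<^sub>m n" "col W 0 = a \<cdot>\<^sub>v v"
proof -
  interpret vec_space "TYPE(complex)" n .
  interpret cof_vec_space n "TYPE(complex)" .
  have n: "0 < n" using v v0 by (cases n) auto
  define ws where "ws = gram_schmidt n (basis_completion v)"
  note bc = basis_completion[OF v v0]
  obtain vs where vs: "basis_completion v = v # vs"
    unfolding basis_completion_def Let_def by blast
  have ws: "set ws \<subseteq> carrier_vec n" "corthogonal ws" "length ws = n"
    using gram_schmidt_result[OF bc(2,4,5) refl] bc(6) by (auto simp: ws_def)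
  have hd: "ws ! 0 = v"
    using gram_schmidt_hd[OF v, of vs] ws(3) n
    by (subst hd_conv_nth[symmetric]) (auto simp: ws_def vs)
  \<comment> \<open>The reciprocal of the norm of \<open>w\<close>. The product
    \<open>w \<bullet>c w\<close> is a complex number with zero imaginary part, hence the detour
    through \<open>Re\<close>; the result is real, so \<open>cnj\<close> fixes it.\<close>
  define a where "a w = complex_of_real (1 / sqrt (Re (w \<bullet>c w)))" for w
  define W where "W = mat n n (\<lambda>(i, j). a (ws ! j) * ws ! j $ i)"
  have W: "W \<in> carrier_mat n n" by (simp add: W_def)
  have wsc: "ws ! i \<in> carrier_vec n" if "i < n" for i using ws that by auto
  have "mat_adjoint W * W = 1\<^sub>m n"
  proof (rule eq_matI)
    fix i j assume "i < dim_row (1\<^sub>m n)" "j < dim_col (1\<^sub>m n)"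
    then have i: "i < n" and j: "j < n" by auto
    have ac: "cnj (a w) = a w" for w by (simp add: a_def)
    have "(mat_adjoint W * W) $$ (i, j) = (\<Sum>k = 0..<n. cnj (W $$ (k, i)) * W $$ (k, j))"
      using i j W by (auto simp: scalar_prod_def)
    also have "\<dots> = a (ws ! i) * a (ws ! j) * (ws ! j \<bullet>c ws ! i)"
      using i j wsc[OF i] wsc[OF j] unfolding scalar_prod_def sum_distrib_left
      by (auto intro!: sum.cong simp: W_def ac)
    also have "\<dots> = 1\<^sub>m n $$ (i, j)"
    proof (cases "i = j")
      case True
      have "0 < ws ! i \<bullet>c ws ! i"
        using corthogonalD[OF ws(2), of i i] i ws(3) wsc[OF i]
        by (metis conjugate_square_greater_0_vec conjugate_square_eq_0_vec)
      then have r: "0 < Re (ws ! i \<bullet>c ws ! i)" "ws ! i \<bullet>c ws ! i = of_real (Re (ws ! i \<bullet>c ws ! i))"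
        by (auto simp: less_complex_def complex_eq_iff)
      have "a (ws ! i) * a (ws ! i) * (ws ! i \<bullet>c ws ! i)
        = of_real (1 / (sqrt (Re (ws ! i \<bullet>c ws ! i)) * sqrt (Re (ws ! i \<bullet>c ws ! i))) * Re (ws ! i \<bullet>c ws ! i))"
        by (subst r(2)) (simp add: a_def del: real_sqrt_mult_self)
      also have "\<dots> = 1" using r(1) by simp
      finally show ?thesis using True i by simp
    next
      case False
      then show ?thesis using corthogonalD[OF ws(2), of j i] i j ws(3) by auto
    qed
    finally show "(mat_adjoint W * W) $$ (i, j) = 1\<^sub>m n $$ (i, j)" .
  qed (use W in auto)
  moreover have "col W 0 = a v \<cdot>\<^sub>v v"
    by (rule eq_vecI) (use W v n hd in \<open>auto simp: W_def\<close>)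
  ultimately show ?thesis using that W by blast
qed

lemma complex_eigenvector_exists:
  fixes A :: "complex mat"
  assumes "A \<in> carrier_mat n n" "0 < n"
  obtains v e where "v \<in> carrier_vec n" "v \<noteq> 0\<^sub>v n" "A *\<^sub>v v = e \<cdot>\<^sub>v v"
proof -
  have "degree (char_poly A) = n" using degree_monic_char_poly assms by blast
  then obtain e where "poly (char_poly A) e = 0"
    using fundamental_theorem_of_algebra[of "char_poly A"] assms(2) by (auto simp: constant_degree)
  then obtain v where "eigenvector A v e"
    using eigenvalue_root_char_poly[OF assms(1)] eigenvalue_def by blast
  then show ?thesis using that assms by (auto simp: eigenvector_def)
qed

text \<open>Deflation: conjugating by a unitary matrix whose first column is an eigenvector keeps
  the matrix Hermitian and splits off a 1 by 1 block. The induction hypothesis diagonalizes the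
  other block.\<close>

theorem hermitian_unitarily_diagonalizable:
  fixes A :: "complex mat"
  assumes "A \<in> carrier_mat n n" "mat_adjoint A = A"
  shows "\<exists>D U. diagonal_mat D \<and> similar_mat_wit A D U (mat_adjoint U)"
  using assms
proof (induction n arbitrary: A)
  case 0
  then show ?case
    by (intro exI[of _ A] exI[of _ "1\<^sub>m 0"])
      (auto simp: diagonal_mat_def intro: similar_mat_wit_refl)
next
  case (Suc m)
  let ?n = "Suc m"
  note A = Suc.prems(1)
  obtain v e where v: "v \<in> carrier_vec ?n" "v \<noteq> 0\<^sub>v ?n" and ev: "A *\<^sub>v v = e \<cdot>\<^sub>v v"
    using complex_eigenvector_exists[OF A] by auto
  obtain W a where W: "W \<in> carrier_mat ?n ?n" and WW: "mat_adjoint W * W = 1\<^sub>m ?n"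
    and col: "col W 0 = a \<cdot>\<^sub>v v"
    using unitary_completion[OF v] by metis
  have WW': "W * mat_adjoint W = 1\<^sub>m ?n"
    using mat_mult_left_right_inverse[OF _ _ WW] W by auto
  define H where "H = mat_adjoint W * A * W"
  have H: "H \<in> carrier_mat ?n ?n" unfolding H_def
    by (intro mult_carrier_mat[of _ _ ?n] mat_adjoint_carrier W A)
  have H': "H = mat_adjoint W * (A * W)" unfolding H_def by (rule assoc_mult_mat) (use W A in auto)
  have simH: "similar_mat_wit H A (mat_adjoint W) W"
    by (rule similar_mat_witI[of _ _ ?n]) (use W A WW WW' H in \<open>auto simp: H_def\<close>)
  have simA: "similar_mat_wit A H W (mat_adjoint W)" using similar_mat_wit_sym[OF simH] .
  have "mat_adjoint H = mat_adjoint (A * W) * mat_adjoint (mat_adjoint W)"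
    unfolding H' by (rule mat_adjoint_mult) (use W A in auto)
  also have "\<dots> = H" unfolding H_def using mat_adjoint_mult[OF A W] Suc.prems(2) by simp
  finally have Hh: "mat_adjoint H = H" .
  have Hsym: "H $$ (i, j) = cnj (H $$ (j, i))" if "i < ?n" "j < ?n" for i j
  proof -
    have "mat_adjoint H $$ (i, j) = cnj (H $$ (j, i))" using that H by (subst index_mat_adjoint) auto
    then show ?thesis using Hh by simp
  qed
  have "A *\<^sub>v col W 0 = e \<cdot>\<^sub>v col W 0"
    unfolding col using v A ev by (simp add: mult_mat_vec smult_smult_assoc mult.commute)
  then have AW0: "col (A * W) 0 = e \<cdot>\<^sub>v col W 0" using A W by (metis col_mult2 zero_less_Suc)
  \<comment> \<open>The first column of \<open>H\<close> is \<open>e\<close> times the first unit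
    vector: \<open>A\<close> scales column 0 of \<open>W\<close> by \<open>e\<close>, and the
    columns of \<open>W\<close> are orthonormal.\<close>
  have H0: "H $$ (i, 0) = (if i = 0 then e else 0)" if "i < ?n" for i
  proof -
    have "H $$ (i, 0) = row (mat_adjoint W) i \<bullet> col (A * W) 0"
      unfolding H' using that A W by simp
    also have "\<dots> = e * (row (mat_adjoint W) i \<bullet> col W 0)" unfolding AW0
    proof (rule scalar_prod_smult_distrib)
      show "row (mat_adjoint W) i \<in> carrier_vec ?n" using W that by auto
      show "col W 0 \<in> carrier_vec ?n" unfolding col using v(1) by simp
    qed
    also have "row (mat_adjoint W) i \<bullet> col W 0 = (mat_adjoint W * W) $$ (i, 0)"
      using W that by simp
    finally show ?thesis using WW that by simp
  qed
  define H3 where "H3 = mat m m (\<lambda>(i, j). H $$ (Suc i, Suc j))"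
  have H3: "H3 \<in> carrier_mat m m" by (simp add: H3_def)
  have "mat_adjoint H3 = H3"
    by (rule eq_matI) (auto simp: H3_def Hsym[symmetric])
  from Suc.IH[OF H3 this] obtain D U where D: "diagonal_mat D"
    and sim: "similar_mat_wit H3 D U (mat_adjoint U)" by blast
  note simD = similar_mat_witD2[OF H3 sim]
  define E where "E = mat 1 1 (\<lambda>_. e)"
  have E: "E \<in> carrier_mat 1 1" by (simp add: E_def)
  \<comment> \<open>Hermitian symmetry carries the zeros of the first column over to the first row,
    which makes \<open>H\<close> block diagonal and not merely block triangular.\<close>
  have H0': "H $$ (0, j) = 0" if "0 < j" "j < ?n" for j
    using H0[of j] that by (subst Hsym) auto
  have Hblock: "H = four_block_mat E (0\<^sub>m 1 m) (0\<^sub>m m 1) H3"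
  proof (rule eq_matI)
    fix i j assume "i < dim_row (four_block_mat E (0\<^sub>m 1 m) (0\<^sub>m m 1) H3)"
      "j < dim_col (four_block_mat E (0\<^sub>m 1 m) (0\<^sub>m m 1) H3)"
    then have ij: "i < ?n" "j < ?n" using E H3 by auto
    show "H $$ (i, j) = four_block_mat E (0\<^sub>m 1 m) (0\<^sub>m m 1) H3 $$ (i, j)"
      using ij by (cases i; cases j) (auto simp: E_def H3_def H0 H0')
  qed (use H E H3 in auto)
  let ?D = "four_block_mat E (0\<^sub>m 1 m) (0\<^sub>m m 1) D"
  let ?U = "four_block_mat (1\<^sub>m 1) (0\<^sub>m 1 m) (0\<^sub>m m 1) U"
  have adjU: "mat_adjoint ?U = four_block_mat (1\<^sub>m 1) (0\<^sub>m 1 m) (0\<^sub>m m 1) (mat_adjoint U)"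
    by (rule eq_matI) (use simD in \<open>auto simp: index_mat_four_block split: if_splits\<close>)
  have "similar_mat_wit H ?D ?U (mat_adjoint ?U)"
    unfolding adjU Hblock
    by (rule similar_mat_wit_four_block[OF similar_mat_wit_refl[OF E] sim _ _ E H3])
      (use simD in auto)
  from similar_mat_wit_trans[OF simA this]
  have "similar_mat_wit A ?D (W * ?U) (mat_adjoint ?U * mat_adjoint W)" .
  moreover have "mat_adjoint (W * ?U) = mat_adjoint ?U * mat_adjoint W"
    by (rule mat_adjoint_mult[OF W]) (use simD in auto)
  moreover have "diagonal_mat ?D"
    using D E simD unfolding diagonal_mat_def by auto
  ultimately show ?case by metis
qed

section \<open>Negative eigenvalues and isotropic vectors\<close>

lemma order_prod_list_linear:
  fixes xs :: "'a :: idom list"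
  shows "order a (\<Prod>x\<leftarrow>xs. [:- x, 1:]) = card {i. i < length xs \<and> xs ! i = a}"
proof -
  have "order a (\<Prod>x\<leftarrow>xs. [:- x, 1:]) = length (filter (\<lambda>x. x = a) xs)"
  proof (induction xs)
    case (Cons x xs)
    let ?p = "\<Prod>x\<leftarrow>xs. [:- x, 1:]"
    have "?p \<noteq> 0" unfolding prod_list_zero_iff by auto
    then have "[:- x, 1:] * ?p \<noteq> 0" by (intro no_zero_divisors) auto
    then have "order a ([:- x, 1:] * ?p) = order a [:- x, 1:] + order a ?p" by (rule order_mult)
    moreover have "order a [:- x, 1:] = (if x = a then 1 else 0)"
    proof (cases "x = a")
      case True
      then show ?thesis using order_power_n_n[of a 1] by (simp only: power_one_right if_True simp_thms)
    qed (simp add: order_0I)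
    moreover have "(\<Prod>x\<leftarrow>x # xs. [:- x, 1:]) = [:- x, 1:] * ?p" by (simp only: list.map prod_list.Cons)
    ultimately show ?case using Cons.IH by (simp only: filter.simps list.size split: if_split) simp
  qed simp
  then show ?thesis by (simp only: length_filter_conv_card)
qed

text \<open>Similarity preserves the characteristic polynomial, and that of \<open>D\<close> splits
  with the diagonal entries as roots, so the algebraic multiplicity of a value counts the diagonal
  positions at which it occurs.\<close>

lemma num_neg_eigenvalues_diagonal:
  assumes A: "A \<in> carrier_mat n n" and D: "diagonal_mat D" and sim: "similar_mat_wit A D U V"
  shows "num_neg_eigenvalues A = card {j. j < n \<and> D $$ (j, j) < 0}"
proof -
  note simD = similar_mat_witD2[OF A sim]
  have Dc: "D \<in> carrier_mat n n" using simD by auto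
  have "char_poly A = char_poly D" using sim by (intro char_poly_similar) (auto simp: similar_mat_def)
  also have "\<dots> = (\<Prod>a\<leftarrow>diag_mat D. [:- a, 1:])"
    by (rule char_poly_upper_triangular[OF Dc]) (use D Dc in \<open>auto simp: diagonal_mat_def\<close>)
  finally have cp: "char_poly A = (\<Prod>a\<leftarrow>diag_mat D. [:- a, 1:])" .
  define C where "C x = {j. j < n \<and> D $$ (j, j) = complex_of_real x}" for x
  have ord: "order (complex_of_real x) (char_poly A) = card (C x)" for x
    unfolding cp order_prod_list_linear C_def
    using Dc by (intro arg_cong[of _ _ card]) (auto simp: diag_mat_def)
  have "set (diag_mat D) = (\<lambda>j. D $$ (j, j)) ` {..<n}"
    using Dc by (auto simp: diag_mat_def)
  have ev: "eigenvalue A (complex_of_real x) \<longleftrightarrow> C x \<noteq> {}" for x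
  proof -
    have "eigenvalue A (complex_of_real x) \<longleftrightarrow> (\<exists>a\<in>set (diag_mat D). poly [:- a, 1:] (complex_of_real x) = 0)"
      unfolding eigenvalue_root_char_poly[OF A] cp poly_prod_list prod_list_zero_iff by auto
    also have "\<dots> \<longleftrightarrow> complex_of_real x \<in> set (diag_mat D)" by auto
    finally show ?thesis
      unfolding \<open>set (diag_mat D) = _\<close> C_def by (auto simp: eq_commute)
  qed
  let ?X = "{x. x < 0 \<and> C x \<noteq> {}}"
  have "?X \<subseteq> (\<lambda>j. Re (D $$ (j, j))) ` {..<n}"
  proof
    fix x assume "x \<in> ?X"
    then obtain j where "j < n" "D $$ (j, j) = complex_of_real x" by (auto simp: C_def)
    then show "x \<in> (\<lambda>j. Re (D $$ (j, j))) ` {..<n}" by (intro image_eqI[of _ _ j]) auto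
  qed
  then have finX: "finite ?X" by (rule finite_subset) simp
  \<comment> \<open>On complex numbers \<open><\<close> requires equal imaginary parts, so a
    negative diagonal entry is automatically real and its position falls into some
    \<open>C x\<close>.\<close>
  have neg: "D $$ (j, j) < 0 \<longleftrightarrow> (\<exists>x<0. D $$ (j, j) = complex_of_real x)" for j
  proof
    assume "D $$ (j, j) < 0"
    then have "Re (D $$ (j, j)) < 0" "D $$ (j, j) = complex_of_real (Re (D $$ (j, j)))"
      by (simp_all add: less_complex_def complex_eq_iff)
    then show "\<exists>x<0. D $$ (j, j) = complex_of_real x" by blast
  qed (auto simp: less_complex_def)
  have UN: "{j. j < n \<and> D $$ (j, j) < 0} = (\<Union>x\<in>?X. C x)"
    unfolding neg C_def by blast
  have "card (\<Union>x\<in>?X. C x) = (\<Sum>x\<in>?X. card (C x))"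
  proof (rule card_UN_disjoint[OF finX])
    show "\<forall>x\<in>?X. finite (C x)" by (simp add: C_def)
    show "\<forall>x\<in>?X. \<forall>y\<in>?X. x \<noteq> y \<longrightarrow> C x \<inter> C y = {}" by (auto simp: C_def)
  qed
  then have "card {j. j < n \<and> D $$ (j, j) < 0} = (\<Sum>x\<in>?X. card (C x))" by (simp only: UN)
  then show ?thesis by (simp add: num_neg_eigenvalues_def ord ev)
qed

lemma index_mult_mat_vec_sum:
  "A \<in> carrier_mat n m \<Longrightarrow> v \<in> carrier_vec m \<Longrightarrow> i < n \<Longrightarrow>
    (A *\<^sub>v v) $ i = (\<Sum>k<m. A $$ (i, k) * v $ k)"
  by (auto simp: scalar_prod_def lessThan_atLeast0)

text \<open>The rows of \<open>L\<close> are conjugated eigenvectors of the negative eigenvalues: on their common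
  kernel the form is positive semidefinite, so an isotropic vector lies in the radical.\<close>

lemma hermitian_isotropic_kernel:
  fixes A :: "complex mat"
  assumes A: "A \<in> carrier_mat n n" and Ah: "mat_adjoint A = A"
  shows "\<exists>(J :: nat set) L. finite J \<and> card J = num_neg_eigenvalues A \<and>
    (\<forall>z\<in>carrier_vec n. (\<forall>j\<in>J. (\<Sum>i<n. L j i * z $ i) = 0) \<longrightarrow>
      (\<forall>i<n. cnj (z $ i) * (A *\<^sub>v z) $ i = 0) \<longrightarrow> A *\<^sub>v z = 0\<^sub>v n)"
proof -
  obtain D U where D: "diagonal_mat D" and sim: "similar_mat_wit A D U (mat_adjoint U)"
    using hermitian_unitarily_diagonalizable[OF assms] by blast
  note simD = similar_mat_witD2[OF A sim]
  have Dc: "D \<in> carrier_mat n n" and U: "U \<in> carrier_mat n n" using simD by auto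
  let ?V = "mat_adjoint U"
  have V: "?V \<in> carrier_mat n n" using U by simp
  have D_eq: "D = ?V * A * U"
    by (rule similar_mat_witD2(3)[OF Dc similar_mat_wit_sym[OF sim]])
  have VA: "?V * A \<in> carrier_mat n n" using V A by (rule mult_carrier_mat)
  have "mat_adjoint D = ?V * (A * U)"
    unfolding D_eq using mat_adjoint_mult[OF VA U] mat_adjoint_mult[OF V A] Ah by simp
  also have "\<dots> = D" unfolding D_eq by (rule assoc_mult_mat[OF V A U, symmetric])
  finally have Dh: "mat_adjoint D = D" .
  have Dreal: "D $$ (j, j) \<in> \<real>" if "j < n" for j
    using arg_cong[OF Dh, of "\<lambda>M. M $$ (j, j)"] that Dc by (simp add: Reals_cnj_iff)
  let ?J = "{j. j < n \<and> D $$ (j, j) < 0}"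
  show ?thesis
  proof (intro exI[of _ ?J] exI[of _ "\<lambda>j i. ?V $$ (j, i)"] conjI ballI impI)
    fix z assume z: "z \<in> carrier_vec n"
      and L: "\<forall>j\<in>?J. (\<Sum>i<n. ?V $$ (j, i) * z $ i) = 0"
      and iso: "\<forall>i<n. cnj (z $ i) * (A *\<^sub>v z) $ i = 0"
    define y where "y = ?V *\<^sub>v z"
    have y: "y \<in> carrier_vec n" unfolding y_def using V z by (rule mult_mat_vec_carrier)
    have Dy: "D *\<^sub>v y \<in> carrier_vec n" using Dc y by (rule mult_mat_vec_carrier)
    have Az: "A *\<^sub>v z = U *\<^sub>v (D *\<^sub>v y)"
    proof -
      have "A *\<^sub>v z = (U * D * ?V) *\<^sub>v z" using simD(3) by simp
      also have "\<dots> = (U * D) *\<^sub>v (?V *\<^sub>v z)"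
        by (rule assoc_mult_mat_vec) (use U Dc V z in auto)
      also have "\<dots> = U *\<^sub>v (D *\<^sub>v y)" unfolding y_def[symmetric]
        by (rule assoc_mult_mat_vec[OF U Dc y])
      finally show ?thesis .
    qed
    have Dyj: "(D *\<^sub>v y) $ j = D $$ (j, j) * y $ j" if j: "j < n" for j
    proof -
      have "(D *\<^sub>v y) $ j = (\<Sum>k<n. if k = j then D $$ (j, k) * y $ k else 0)"
        unfolding index_mult_mat_vec_sum[OF Dc y j]
        using D Dc j by (intro sum.cong) (auto simp: diagonal_mat_def)
      then show ?thesis using j by simp
    qed
    \<comment> \<open>Summing the isotropy over \<open>i\<close> shows that the Hermitian form of
      \<open>A\<close> vanishes at \<open>z\<close>. In the eigenbasis coordinates \<open>y\<close>
      this form is the sum of squared moduli weighted by the eigenvalues.\<close>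
    have "0 = (\<Sum>i<n. cnj (z $ i) * (A *\<^sub>v z) $ i)"
      by (rule sum.neutral[symmetric]) (use iso in blast)
    also have "\<dots> = (\<Sum>i<n. \<Sum>j<n. cnj (z $ i) * (U $$ (i, j) * (D *\<^sub>v y) $ j))"
      unfolding Az by (intro sum.cong refl)
        (simp del: index_mult_mat_vec add: index_mult_mat_vec_sum[OF U Dy] sum_distrib_left)
    also have "\<dots> = (\<Sum>j<n. \<Sum>i<n. cnj (z $ i) * (U $$ (i, j) * (D *\<^sub>v y) $ j))"
      by (rule sum.swap)
    also have "\<dots> = (\<Sum>j<n. D $$ (j, j) * (cmod (y $ j))\<^sup>2)"
    proof (rule sum.cong[OF refl])
      fix j assume "j \<in> {..<n}"
      then have j: "j < n" by simp
      have "cnj (y $ j) = (\<Sum>i<n. cnj (z $ i) * U $$ (i, j))"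
        unfolding y_def index_mult_mat_vec_sum[OF V z j] using U j
        by (auto intro!: sum.cong simp: mult.commute)
      then have "(\<Sum>i<n. cnj (z $ i) * (U $$ (i, j) * (D *\<^sub>v y) $ j)) = cnj (y $ j) * (D $$ (j, j) * y $ j)"
        unfolding Dyj[OF j] by (simp add: sum_distrib_right mult.assoc)
      also have "\<dots> = D $$ (j, j) * (cmod (y $ j))\<^sup>2"
        by (metis complex_norm_square mult.assoc mult.commute)
      finally show "(\<Sum>i<n. cnj (z $ i) * (U $$ (i, j) * (D *\<^sub>v y) $ j)) = D $$ (j, j) * (cmod (y $ j))\<^sup>2" .
    qed
    finally have sum0: "0 = (\<Sum>j<n. D $$ (j, j) * (cmod (y $ j))\<^sup>2)" .
    have yJ: "y $ j = 0" if "j < n" "D $$ (j, j) < 0" for j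
      using bspec[OF L, of j] that unfolding y_def index_mult_mat_vec_sum[OF V z that(1)] by simp
    have Re0: "0 = (\<Sum>j<n. Re (D $$ (j, j)) * (cmod (y $ j))\<^sup>2)"
      using arg_cong[OF sum0, of Re] by (simp add: Re_sum del: Re_complex_of_real) (simp add: power2_eq_square)
    \<comment> \<open>The equations of \<open>L\<close> remove the terms with negative eigenvalue.
      The rest is a sum of nonnegative terms with value zero, so each term vanishes.\<close>
    have nonneg: "0 \<le> Re (D $$ (j, j)) * (cmod (y $ j))\<^sup>2" if "j < n" for j
    proof (cases "D $$ (j, j) < 0")
      case False
      then have "0 \<le> Re (D $$ (j, j))"
        using Dreal[OF that] by (auto simp: less_complex_def complex_is_Real_iff)
      then show ?thesis by simp
    qed (use yJ that in simp)
    have zero: "Re (D $$ (j, j)) * (cmod (y $ j))\<^sup>2 = 0" if "j < n" for j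
      using sum_nonneg_eq_0_iff[of "{..<n}" "\<lambda>j. Re (D $$ (j, j)) * (cmod (y $ j))\<^sup>2"] nonneg Re0 that
      by auto
    have "D *\<^sub>v y = 0\<^sub>v n"
    proof (rule eq_vecI)
      fix j assume "j < dim_vec (0\<^sub>v n)"
      then have j: "j < n" by simp
      then show "(D *\<^sub>v y) $ j = 0\<^sub>v n $ j"
        using zero[OF j] Dreal[OF j] unfolding Dyj[OF j]
        by (auto simp: complex_is_Real_iff complex_eq_iff)
    qed (use Dc in simp)
    then show "A *\<^sub>v z = 0\<^sub>v n" unfolding Az using U by auto
  next
    show "card ?J = num_neg_eigenvalues A" using num_neg_eigenvalues_diagonal[OF A D sim] by simp
  qed simp
qed

section \<open>Linear systems and the dimension of the kernel\<close>

text \<open>Elimination, by induction on the equations: an equation with a nonzero coefficient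
  removes one unknown, and an equation without one holds for every choice.\<close>

lemma underdetermined_system:
  fixes f :: "'a \<Rightarrow> 'b \<Rightarrow> 'c :: field"
  assumes "finite I" "card I < card S"
  shows "\<exists>c. (\<exists>s\<in>S. c s \<noteq> 0) \<and> (\<forall>i\<in>I. (\<Sum>s\<in>S. c s * f s i) = 0)"
  using assms
proof (induction I arbitrary: S f rule: finite_induct)
  case empty
  then have "S \<noteq> {}" by auto
  then show ?case by (intro exI[of _ "\<lambda>_. 1"]) auto
next
  case (insert i I)
  \<comment> \<open>An infinite \<open>S\<close> would have cardinality 0, which exceeds
    nothing.\<close>
  have S: "finite S" using insert.prems by (metis card.infinite not_less_zero)
  show ?case
  proof (cases "\<forall>s\<in>S. f s i = 0")
    case True
    have "card I < card S" using insert by simp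
    from insert.IH[OF this, of f] show ?thesis using True by auto
  next
    case False
    then obtain t where t: "t \<in> S" "f t i \<noteq> 0" by auto
    let ?S = "S - {t}"
    have "card I < card ?S" using insert t S by simp
    \<comment> \<open>Every column loses the multiple of column \<open>t\<close> that clears its
      entry in equation \<open>i\<close>.\<close>
    from insert.IH[OF this, of "\<lambda>s j. f s j - f s i / f t i * f t j"]
    obtain c where c: "\<exists>s\<in>?S. c s \<noteq> 0"
      "\<And>j. j \<in> I \<Longrightarrow> (\<Sum>s\<in>?S. c s * (f s j - f s i / f t i * f t j)) = 0" by auto
    \<comment> \<open>The value at \<open>t\<close> is solved from equation
      \<open>i\<close>.\<close>
    define d where "d = c(t := - (\<Sum>s\<in>?S. c s * (f s i / f t i)))"
    have d: "(\<Sum>s\<in>S. d s * f s j) = (\<Sum>s\<in>?S. c s * (f s j - f s i / f t i * f t j))" for j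
    proof -
      have "(\<Sum>s\<in>S. d s * f s j) = d t * f t j + (\<Sum>s\<in>?S. c s * f s j)"
        using S t by (subst sum.remove[of _ t]) (auto simp: d_def intro!: sum.cong)
      also have "\<dots> = (\<Sum>s\<in>?S. c s * (f s j - f s i / f t i * f t j))"
        by (simp add: d_def sum_distrib_right sum_subtractf right_diff_distrib mult.assoc)
      finally show ?thesis .
    qed
    have "(\<Sum>s\<in>S. d s * f s i) = 0" unfolding d using t by simp
    moreover have "\<exists>s\<in>S. d s \<noteq> 0" using c(1) by (auto simp: d_def)
    ultimately show ?thesis using c(2) d by (intro exI[of _ d]) auto
  qed
qed

text \<open>If a basis of the kernel had more vectors than \<open>I\<close> has elements, some
  nontrivial combination of them would vanish on \<open>I\<close>. By \<open>det\<close> it would be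
  zero, against linear independence.\<close>

lemma kernel_dim_le_card:
  fixes A :: "'a :: field mat"
  assumes A: "A \<in> carrier_mat m n" and I: "I \<subseteq> {..<n}"
    and det: "\<And>y. y \<in> mat_kernel A \<Longrightarrow> (\<And>i. i \<in> I \<Longrightarrow> y $ i = 0) \<Longrightarrow> y = 0\<^sub>v n"
  shows "kernel_dim A \<le> card I"
proof (rule ccontr)
  assume "\<not> kernel_dim A \<le> card I"
  interpret kernel m n A by unfold_locales (rule A)
  obtain B where B: "finite B" "basis B" using kernel_basis_exists[OF A] by blast
  then have Bsub: "B \<subseteq> mat_kernel A" and ind: "\<not> lin_dep B" by (auto simp: Ker.basis_def)
  have "card I < card B" using \<open>\<not> kernel_dim A \<le> card I\<close> Ker.dim_basis[OF B] by simp
  moreover have "finite I" using I finite_subset by blast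
  ultimately obtain c where c: "\<exists>s\<in>B. c s \<noteq> 0" "\<And>i. i \<in> I \<Longrightarrow> (\<Sum>s\<in>B. c s * s $ i) = 0"
    using underdetermined_system[of I B "\<lambda>s i. s $ i"] by blast
  have "lincomb c B \<in> mat_kernel A" using Ker.lincomb_closed[OF Bsub] by auto
  moreover have "lincomb c B $ i = 0" if "i \<in> I" for i
    using c(2)[OF that] lincomb_index[of i B c] Bsub I that by auto
  ultimately have "lincomb c B = 0\<^sub>v n" by (rule det)
  moreover obtain s where "s \<in> B" "c s \<noteq> 0" using c(1) by blast
  ultimately have "lin_dep B" unfolding Ker.lin_dep_def using B(1)
    by (intro exI[of _ B] exI[of _ c] exI[of _ s]) auto
  then show False using ind by blast
qed

section \<open>The forcing game\<close>

lemma component_sets_subset: "W \<in> component_sets E U \<Longrightarrow> W \<subseteq> U"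
proof -
  have "y \<in> U" if "(x, y) \<in> (Restr E U)\<^sup>*" "x \<in> U" for x y
    using that by (induction rule: rtrancl_induct) auto
  then show "W \<in> component_sets E U \<Longrightarrow> W \<subseteq> U"
    by (auto simp: component_sets_def quotient_def)
qed

lemma component_sets_closed:
  assumes "W \<in> component_sets E U" "i \<in> W" "(i, k) \<in> E" "k \<in> U"
  shows "k \<in> W"
proof -
  have "i \<in> U" using component_sets_subset assms(1,2) by blast
  then show ?thesis using assms
    by (auto simp: component_sets_def quotient_def intro: rtrancl_into_rtrancl)
qed

lemma component_sets_unique:
  assumes "sym E" "W \<in> component_sets E U" "W' \<in> component_sets E U" "i \<in> W" "i \<in> W'"
  shows "W = W'"
proof -
  have "sym ((Restr E U)\<^sup>*)"
    using assms(1) by (intro sym_rtrancl) (auto simp: sym_def)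
  then have "V = (Restr E U)\<^sup>* `` {i}" if "V \<in> component_sets E U" "i \<in> V" for V
    using that by (auto simp: component_sets_def quotient_def dest: symD intro: rtrancl_trans)
  then show ?thesis using assms by metis
qed

text \<open>Take a vector of maximal support: adding a generic multiple of \<open>y\<close> would enlarge it.\<close>

lemma mat_kernel_generic_vector:
  fixes A :: "'a :: field_char_0 mat" and B :: "nat set"
  assumes A: "A \<in> carrier_mat m n"
  defines "N \<equiv> {y \<in> mat_kernel A. \<forall>k<n. k \<in> B \<longrightarrow> y $ k = 0}"
  shows "\<exists>x\<in>N. \<forall>y\<in>N. \<forall>i<n. x $ i = 0 \<longrightarrow> y $ i = 0"
proof -
  let ?s = "\<lambda>y. card {i. i < n \<and> y $ i \<noteq> 0}"
  have N: "y \<in> carrier_vec n" "A *\<^sub>v y = 0\<^sub>v m" if "y \<in> N" for y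
    using that mat_kernelD[OF A] by (auto simp: N_def)
  have "0\<^sub>v n \<in> N" using A by (auto simp: N_def intro!: mat_kernelI)
  moreover have "?s y \<le> n" for y
    using card_mono[of "{..<n}" "{i. i < n \<and> y $ i \<noteq> 0}"] by auto
  ultimately have "\<exists>x. x \<in> N \<and> (\<forall>y. y \<in> N \<longrightarrow> ?s y \<le> ?s x)"
    by (intro ex_has_greatest_nat[of _ "0\<^sub>v n" _ "Suc n"]) (auto simp: less_Suc_eq_le)
  then obtain x where x: "x \<in> N" and max: "\<And>y. y \<in> N \<Longrightarrow> ?s y \<le> ?s x" by blast
  show ?thesis
  proof (intro bexI[of _ x] ballI allI impI)
    fix y i assume y: "y \<in> N" and i: "i < n" "x $ i = 0"
    show "y $ i = 0"
    proof (rule ccontr)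
      assume yi: "y $ i \<noteq> 0"
      \<comment> \<open>A field of characteristic 0 is infinite, so \<open>t\<close> can avoid the
        finitely many values at which a nonzero coordinate of \<open>x\<close> cancels. It also
        avoids 0, so coordinate \<open>i\<close> becomes nonzero. Where \<open>y $ k = 0\<close>,
        the quotient is 0 by convention and excludes nothing new.\<close>
      have "finite (insert 0 ((\<lambda>k. - x $ k / y $ k) ` {..<n}))" by simp
      then obtain t where t: "t \<notin> insert 0 ((\<lambda>k. - x $ k / y $ k) ` {..<n})"
        using ex_new_if_finite[OF infinite_UNIV_char_0] by blast
      let ?w = "x + t \<cdot>\<^sub>v y"
      have w: "?w $ k = x $ k + t * y $ k" if "k < n" for k using that N[OF y] by simp
      have "A *\<^sub>v ?w = A *\<^sub>v x + t \<cdot>\<^sub>v (A *\<^sub>v y)"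
        using A N[OF x] N[OF y] by (simp add: mult_add_distrib_mat_vec mult_mat_vec)
      also have "\<dots> = 0\<^sub>v m" unfolding N(2)[OF x] N(2)[OF y] by (rule eq_vecI) auto
      finally have "A *\<^sub>v ?w = 0\<^sub>v m" .
      then have "?w \<in> mat_kernel A"
        using N[OF x] N[OF y] by (intro mat_kernelI[OF A]) auto
      moreover have "?w $ k = 0" if "k < n" "k \<in> B" for k
        using x y that unfolding w[OF that(1)] N_def by simp
      ultimately have "?w \<in> N" by (simp add: N_def)
      moreover have "{k. k < n \<and> x $ k \<noteq> 0} \<subset> {k. k < n \<and> ?w $ k \<noteq> 0}"
      proof (intro psubsetI subsetI)
        fix k assume k: "k \<in> {k. k < n \<and> x $ k \<noteq> 0}"
        have "x $ k + t * y $ k \<noteq> 0"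
        proof
          assume e: "x $ k + t * y $ k = 0"
          then have "y $ k \<noteq> 0" using k by auto
          moreover have "t * y $ k = - x $ k" using e by (simp add: add_eq_0_iff2)
          ultimately have "t = - x $ k / y $ k" by (metis nonzero_eq_divide_eq)
          then have "t \<in> (\<lambda>k. - x $ k / y $ k) ` {..<n}" using k by (intro image_eqI[of _ _ k]) auto
          then show False using t by blast
        qed
        then show "k \<in> {k. k < n \<and> ?w $ k \<noteq> 0}" using k w by auto
      next
        have "i \<in> {k. k < n \<and> ?w $ k \<noteq> 0}" using i yi t w by auto
        then show "{k. k < n \<and> x $ k \<noteq> 0} \<noteq> {k. k < n \<and> ?w $ k \<noteq> 0}" using i by blast
      qed
      then have "?s x < ?s ?w" by (intro psubset_card_mono) auto
      ultimately show False using max[of ?w] by linarith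
    qed
  qed (rule x)
qed

text \<open>A recolored vertex is the target of an edge of \<open>F\<close>. For an induced subgraph
  this confines the newly black vertices to that subgraph.\<close>

lemma recolor_mono: "(recolor F)\<^sup>*\<^sup>* C C' \<Longrightarrow> C' \<subseteq> C \<union> Range F"
proof (induction rule: rtranclp_induct)
  case (step D D')
  from step.hyps(2) have "D' \<subseteq> D \<union> Range F" by cases auto
  then show ?case using step.IH by blast
qed auto

section \<open>Kernel vectors of a matrix of the graph under the moves of the game\<close>

context
  fixes n :: nat and E :: "(nat \<times> nat) set" and A :: "complex mat"
  assumes graph: "simple_graph n E" and A_graph: "A \<in> hermitian_matrices_of_graph n E"
begin

lemma graph_matrix_carrier: "A \<in> carrier_mat n n"
  using A_graph by (simp add: hermitian_matrices_of_graph_def)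

lemma graph_matrix_hermitian: "mat_adjoint A = A"
  using A_graph by (simp add: hermitian_matrices_of_graph_def)

lemma graph_matrix_edge: "i < n \<Longrightarrow> j < n \<Longrightarrow> A $$ (i, j) \<noteq> 0 \<Longrightarrow> i = j \<or> (i, j) \<in> E"
  using A_graph by (auto simp: hermitian_matrices_of_graph_def)

lemma edge_in_range: "(i, j) \<in> E \<Longrightarrow> i < n \<and> j < n \<and> i \<noteq> j \<and> A $$ (i, j) \<noteq> 0"
proof -
  assume e: "(i, j) \<in> E"
  then have "i < n" "j < n" "i \<noteq> j"
    using graph by (auto simp: simple_graph_def irrefl_def)
  then show ?thesis using e A_graph by (simp add: hermitian_matrices_of_graph_def)
qed

text \<open>If \<open>u\<close> forces \<open>w\<close>, then in row \<open>u\<close> of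
  \<open>A *\<^sub>v z\<close> every term except that of \<open>w\<close> vanishes: black vertices,
  \<open>u\<close> included, have coordinate 0 by induction, and vertices outside \<open>U\<close>
  lie off the support of \<open>z\<close>. What remains is a nonzero entry of \<open>A\<close> times
  \<open>z $ w\<close>.\<close>

lemma recolor_kernel_vanishes:
  assumes "(recolor (Restr E U))\<^sup>*\<^sup>* C C'" and z: "z \<in> mat_kernel A"
    and supp: "\<And>i. i < n \<Longrightarrow> z $ i \<noteq> 0 \<Longrightarrow> i \<in> U"
    and C: "\<And>i. i < n \<Longrightarrow> i \<in> C \<Longrightarrow> z $ i = 0"
  shows "i < n \<Longrightarrow> i \<in> C' \<Longrightarrow> z $ i = 0"
  using assms(1)
proof (induction arbitrary: i rule: rtranclp_induct)
  case base
  then show ?case using C by blast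
next
  case (step D D')
  note zc = mat_kernelD[OF graph_matrix_carrier z]
  from step.hyps(2) obtain u w where u: "u \<in> D" and w: "Restr E U `` {u} - D = {w}"
    and D': "D' = insert w D" by cases auto
  have uw: "(u, w) \<in> E" "u \<in> U" using w by auto
  note uw_n = edge_in_range[OF uw(1)]
  have "0 = (A *\<^sub>v z) $ u" using zc uw_n by simp
  also have "\<dots> = (\<Sum>k<n. A $$ (u, k) * z $ k)"
    using uw_n by (intro index_mult_mat_vec_sum[OF graph_matrix_carrier zc(1)]) auto
  also have "\<dots> = (\<Sum>k<n. if k = w then A $$ (u, w) * z $ w else 0)"
  proof (rule sum.cong[OF refl])
    fix k assume k: "k \<in> {..<n}"
    have "A $$ (u, k) = 0 \<or> z $ k = 0" if "k \<noteq> w"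
    proof (rule ccontr)
      assume "\<not> ?thesis"
      then have nz: "A $$ (u, k) \<noteq> 0" "z $ k \<noteq> 0" by auto
      then have "k \<notin> D" using step.IH k by auto
      then have "(u, k) \<in> E" using graph_matrix_edge[of u k] nz k uw_n u by auto
      then have "k \<in> Restr E U `` {u} - D" using \<open>k \<notin> D\<close> uw supp nz k by auto
      then show False using w that by auto
    qed
    then show "A $$ (u, k) * z $ k = (if k = w then A $$ (u, w) * z $ w else 0)" by auto
  qed
  also have "\<dots> = A $$ (u, w) * z $ w" using uw_n by simp
  finally have "z $ w = 0" using uw_n by simp
  then show ?case using step D' by auto
qed

text \<open>Multiplying \<open>x\<close> by a function that is constant on the components multiplies \<open>A x\<close> in the
  same way on the white vertices, so the product is isotropic.\<close>

lemma component_multiple_isotropic: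
  assumes x: "x \<in> mat_kernel A" and x0: "\<And>i. i < n \<Longrightarrow> i \<in> B \<Longrightarrow> x $ i = 0"
    and d: "\<And>i k. (i, k) \<in> E \<Longrightarrow> i \<notin> B \<Longrightarrow> k \<notin> B \<Longrightarrow> d i = d k" and i: "i < n"
  shows "cnj (d i * x $ i) * (A *\<^sub>v vec n (\<lambda>k. d k * x $ k)) $ i = 0"
proof (cases "i \<in> B")
  case False
  note xc = mat_kernelD[OF graph_matrix_carrier x]
  have "(A *\<^sub>v vec n (\<lambda>k. d k * x $ k)) $ i = (\<Sum>k<n. A $$ (i, k) * (d k * x $ k))"
    by (subst index_mult_mat_vec_sum[OF graph_matrix_carrier _ i]) auto
  also have "\<dots> = (\<Sum>k<n. d i * (A $$ (i, k) * x $ k))"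
  proof (rule sum.cong[OF refl])
    fix k assume k: "k \<in> {..<n}"
    show "A $$ (i, k) * (d k * x $ k) = d i * (A $$ (i, k) * x $ k)"
    proof (cases "A $$ (i, k) = 0 \<or> x $ k = 0")
      case nz: False
      \<comment> \<open>A nonzero term comes from \<open>i\<close> itself or from a white neighbor,
        where \<open>d\<close> has the same value.\<close>
      then have "k \<notin> B" "i = k \<or> (i, k) \<in> E"
        using x0[of k] graph_matrix_edge[OF i, of k] k by auto
      then have "d i = d k" using d False by blast
      then show ?thesis by simp
    qed auto
  qed
  also have "\<dots> = d i * (A *\<^sub>v x) $ i"
    by (subst index_mult_mat_vec_sum[OF graph_matrix_carrier xc(1) i]) (simp add: sum_distrib_left)
  finally show ?thesis using xc i by simp
qed (use x0 i in simp)

text \<open>White's reply against a single kernel vector \<open>x\<close>: weights on the announced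
  components turn \<open>x\<close> into another kernel vector, and the reply consists of the
  components of nonzero weight.\<close>

lemma announce_exists_selection:
  assumes x: "x \<in> mat_kernel A" and x0: "\<And>i. i < n \<Longrightarrow> i \<in> B \<Longrightarrow> x $ i = 0"
    and S: "S \<subseteq> component_sets E ({0..<n} - B)" and card: "num_neg_eigenvalues A < card S"
  shows "\<exists>T\<subseteq>S. T \<noteq> {} \<and>
    (\<forall>C. (recolor (Restr E (B \<union> \<Union>T)))\<^sup>*\<^sup>* B C \<longrightarrow> (\<forall>i<n. i \<in> C \<longrightarrow> x $ i = 0))"
proof -
  let ?U = "{0..<n} - B"
  obtain J :: "nat set" and L where J: "finite J" "card J = num_neg_eigenvalues A"
    and iso: "\<forall>z\<in>carrier_vec n. (\<forall>j\<in>J. (\<Sum>i<n. L j i * z $ i) = 0) \<longrightarrow>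
      (\<forall>i<n. cnj (z $ i) * (A *\<^sub>v z) $ i = 0) \<longrightarrow> A *\<^sub>v z = 0\<^sub>v n"
    using hermitian_isotropic_kernel[OF graph_matrix_carrier graph_matrix_hermitian] by blast
  \<comment> \<open>One unknown per component and one equation per element of \<open>J\<close>: the
    weighted sum of the restrictions of \<open>x\<close> has to satisfy all equations of
    \<open>L\<close>.\<close>
  obtain c where c: "\<exists>W\<in>S. c W \<noteq> 0"
    and cJ: "\<And>j. j \<in> J \<Longrightarrow> (\<Sum>W\<in>S. c W * (\<Sum>i<n. L j i * (if i \<in> W then x $ i else 0))) = 0"
    using underdetermined_system[OF J(1), of S "\<lambda>W j. \<Sum>i<n. L j i * (if i \<in> W then x $ i else 0)"]
      card[folded J(2)] by blast
  have finS: "finite S" using card by (metis card.infinite not_less_zero)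
  have symE: "sym E" using graph by (simp add: simple_graph_def)
  \<comment> \<open>The weight of the component containing \<open>i\<close>. Components are
    disjoint, so at most one summand is nonzero; outside the announced components \<open>d\<close>
    is 0.\<close>
  define d where "d i = (\<Sum>W\<in>S. if i \<in> W then c W else 0)" for i
  have d_in: "d i = c W" if "W \<in> S" "i \<in> W" for i W
  proof -
    have "d i = (\<Sum>V\<in>S. if V = W then c W else 0)" unfolding d_def
    proof (rule sum.cong[OF refl])
      fix V assume "V \<in> S"
      then have "i \<in> V \<longleftrightarrow> V = W"
        using component_sets_unique[OF symE, of V ?U W i] S that by blast
      then show "(if i \<in> V then c V else 0) = (if V = W then c W else 0)" by simp
    qed
    then show ?thesis using finS that by simp
  qed
  have d_out: "d i = 0" if "i \<notin> \<Union>S" for i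
    unfolding d_def using that by (intro sum.neutral) auto
  define z where "z = vec n (\<lambda>i. d i * x $ i)"
  have "A *\<^sub>v z = 0\<^sub>v n"
  proof (rule iso[rule_format])
    fix j assume "j \<in> J"
    have "(\<Sum>i<n. L j i * z $ i) = (\<Sum>i<n. \<Sum>W\<in>S. c W * (L j i * (if i \<in> W then x $ i else 0)))"
    proof (rule sum.cong[OF refl])
      fix i assume "i \<in> {..<n}"
      then have "L j i * z $ i = (\<Sum>W\<in>S. L j i * ((if i \<in> W then c W else 0) * x $ i))"
        by (simp add: z_def d_def sum_distrib_left sum_distrib_right)
      also have "\<dots> = (\<Sum>W\<in>S. c W * (L j i * (if i \<in> W then x $ i else 0)))"
        by (rule sum.cong[OF refl]) simp
      finally show "L j i * z $ i = \<dots>" .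
    qed
    also have "\<dots> = (\<Sum>W\<in>S. \<Sum>i<n. c W * (L j i * (if i \<in> W then x $ i else 0)))"
      by (rule sum.swap)
    finally show "(\<Sum>i<n. L j i * z $ i) = 0"
      using cJ[OF \<open>j \<in> J\<close>] by (simp add: sum_distrib_left)
  next
    fix i assume i: "i < n"
    have "d i = d k" if e: "(i, k) \<in> E" "i \<notin> B" "k \<notin> B" for i k
    proof -
      have step: "k \<in> W" if "W \<in> S" "i \<in> W" "(i, k) \<in> E" "k \<notin> B" for W i k
      proof (rule component_sets_closed)
        show "W \<in> component_sets E ?U" using S that by blast
        show "k \<in> ?U" using edge_in_range[OF that(3)] that by simp
      qed (use that in blast)+
      have e': "(k, i) \<in> E" using e(1) symE by (rule symD[rotated])
      show ?thesis
      proof (cases "\<exists>W\<in>S. i \<in> W")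
        case True
        then obtain W where W: "W \<in> S" "i \<in> W" by blast
        then show ?thesis using d_in[OF W] d_in[OF W(1) step[OF W e(1,3)]] by simp
      next
        case False
        then have "\<not> (\<exists>W\<in>S. k \<in> W)" using step[OF _ _ e' e(2)] by blast
        then show ?thesis using False d_out[of i] d_out[of k] by (simp add: Union_iff)
      qed
    qed
    from component_multiple_isotropic[OF x x0 this i]
    show "cnj (z $ i) * (A *\<^sub>v z) $ i = 0" using i by (simp add: z_def)
  qed (simp add: z_def)
  then have zker: "z \<in> mat_kernel A" by (intro mat_kernelI[OF graph_matrix_carrier]) (auto simp: z_def)
  \<comment> \<open>With the zero weights dropped, \<open>d\<close> is nonzero on all of
    \<open>\<Union>T\<close> and \<open>z\<close> is supported there.\<close>
  define T where "T = {W \<in> S. c W \<noteq> 0}"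
  show ?thesis
  proof (intro exI[of _ T] conjI allI impI)
    show "T \<noteq> {}" "T \<subseteq> S" using c by (auto simp: T_def)
  next
    fix C i assume rec: "(recolor (Restr E (B \<union> \<Union>T)))\<^sup>*\<^sup>* B C"
      and i: "i < n" "i \<in> C"
    have z0: "z $ k = 0" if "k < n" "k \<in> B" for k using x0[OF that] that by (simp add: z_def)
    have "z $ i = 0"
    proof (rule recolor_kernel_vanishes[OF rec zker _ _ i])
      fix k assume k: "k < n" "z $ k \<noteq> 0"
      then have "d k \<noteq> 0" by (auto simp: z_def)
      then obtain W where "W \<in> S" "k \<in> W" using d_out by blast
      then show "k \<in> B \<union> \<Union>T" using d_in[of W k] \<open>d k \<noteq> 0\<close> by (auto simp: T_def)
    qed (rule z0)
    then have "d i * x $ i = 0" using i by (simp add: z_def)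
    \<comment> \<open>All vertices of \<open>C\<close> lie in \<open>B\<close> or in
      \<open>\<Union>T\<close>; on the latter \<open>d\<close> is nonzero and can be
      cancelled.\<close>
    moreover have "i \<in> B \<or> i \<in> \<Union>T" using recolor_mono[OF rec] i by blast
    ultimately show "x $ i = 0"
    proof (elim disjE)
      assume "i \<in> \<Union>T"
      then obtain W where "W \<in> S" "i \<in> W" "c W \<noteq> 0" by (auto simp: T_def)
      then show ?thesis using d_in[of W i] \<open>d i * x $ i = 0\<close> by simp
    qed (rule x0[OF i(1)])
  qed
qed

text \<open>The set \<open>I\<close> collects vertices bought on one line of play, in which White
  answers each announcement as in \<open>announce_exists_selection\<close>.\<close>

lemma black_can_finish_determining_set:
  assumes "black_can_finish (num_neg_eigenvalues A) {0..<n} E B k"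
  shows "\<exists>I\<subseteq>{..<n}. card I \<le> k \<and>
    (\<forall>y\<in>mat_kernel A. (\<forall>i<n. i \<in> B \<union> I \<longrightarrow> y $ i = 0) \<longrightarrow> y = 0\<^sub>v n)"
  using assms
proof (induction rule: black_can_finish.induct)
  case (all_black k)
  show ?case
    using mat_kernelD(1)[OF graph_matrix_carrier] by (intro exI[of _ "{}"]) (auto intro!: eq_vecI)
next
  case (token v B k)
  then obtain I where "I \<subseteq> {..<n}" "card I \<le> k"
    "\<forall>y\<in>mat_kernel A. (\<forall>i<n. i \<in> insert v B \<union> I \<longrightarrow> y $ i = 0) \<longrightarrow> y = 0\<^sub>v n" by blast
  then show ?case using token.hyps
    by (intro exI[of _ "insert v I"]) (auto simp: card_insert_if finite_subset)
next
  case (color_change B B' k)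
  \<comment> \<open>With \<open>U = UNIV\<close> the induced subgraph is the whole graph and the
    support condition is void.\<close>
  have B': "y $ i = 0" if "y \<in> mat_kernel A" "\<forall>i<n. i \<in> B \<longrightarrow> y $ i = 0" "i < n" "i \<in> B'" for y i
    by (rule recolor_kernel_vanishes[of UNIV B B']) (use color_change.hyps that in auto)
  obtain I where I: "I \<subseteq> {..<n}" "card I \<le> k"
    "\<And>y. y \<in> mat_kernel A \<Longrightarrow> \<forall>i<n. i \<in> B' \<union> I \<longrightarrow> y $ i = 0 \<Longrightarrow> y = 0\<^sub>v n"
    using color_change.IH by blast
  have "y = 0\<^sub>v n" if "y \<in> mat_kernel A" "\<forall>i<n. i \<in> B \<union> I \<longrightarrow> y $ i = 0" for y
    using I(3)[OF that(1)] B'[OF that(1)] that(2) by blast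
  then show ?case using I(1,2) by blast
next
  case (announce S B k)
  define N where "N = {y \<in> mat_kernel A. \<forall>i<n. i \<in> B \<longrightarrow> y $ i = 0}"
  \<comment> \<open>The reply \<open>T\<close>, and with it \<open>I\<close>, is built from one
    vector. Choosing one whose zeros are shared by all of \<open>N\<close> lets the same reply serve
    every vector of \<open>N\<close>.\<close>
  obtain x where x: "x \<in> N" and gen: "\<forall>y\<in>N. \<forall>i<n. x $ i = 0 \<longrightarrow> y $ i = 0"
    using mat_kernel_generic_vector[OF graph_matrix_carrier, of B] unfolding N_def by blast
  have "num_neg_eigenvalues A < card S" using announce.hyps(3) by simp
  from announce_exists_selection[OF _ _ announce.hyps(1) this, of x] x
  obtain T where T: "T \<noteq> {}" "T \<subseteq> S"
    and van: "\<forall>C. (recolor (Restr E (B \<union> \<Union>T)))\<^sup>*\<^sup>* B C \<longrightarrow> (\<forall>i<n. i \<in> C \<longrightarrow> x $ i = 0)"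
    unfolding N_def by blast
  from announce.IH[rule_format, OF conjI[OF T]]
  obtain B' I where B': "(recolor (Restr E (B \<union> \<Union>T)))\<^sup>*\<^sup>* B B'"
    and I: "I \<subseteq> {..<n}" "card I \<le> k"
      "\<forall>y\<in>mat_kernel A. (\<forall>i<n. i \<in> B' \<union> I \<longrightarrow> y $ i = 0) \<longrightarrow> y = 0\<^sub>v n"
    by (elim exE conjE) (rule that)
  have "y = 0\<^sub>v n" if y: "y \<in> mat_kernel A" "\<forall>i<n. i \<in> B \<union> I \<longrightarrow> y $ i = 0" for y
  proof -
    have "y \<in> N" using y by (simp add: N_def)
    then have "\<forall>i<n. i \<in> B' \<longrightarrow> y $ i = 0" using gen van B' by blast
    then show ?thesis using I(3) y by blast
  qed
  then show ?case using I by blast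
qed

end

theorem theorem8:
  fixes n q :: nat and E :: "(nat \<times> nat) set" and A :: "complex mat"
  assumes "simple_graph n E"
    and "A \<in> hermitian_matrices_of_graph n E"
    and "num_neg_eigenvalues A = q"
  shows "kernel_dim A \<le> Z_forcing_number q {0..<n} E"
proof -
  have "black_can_finish q {0..<n} E {} (Z_forcing_number q {0..<n} E)"
    by (rule black_can_finish_Z_forcing_number) simp
  \<comment> \<open>Initially no vertex is black, so the coordinates in \<open>I\<close> alone
    determine a kernel vector.\<close>
  from black_can_finish_determining_set[OF assms(1,2), unfolded assms(3), OF this]
  obtain I where I: "I \<subseteq> {..<n}" "card I \<le> Z_forcing_number q {0..<n} E"
    "\<And>y. y \<in> mat_kernel A \<Longrightarrow> (\<And>i. i \<in> I \<Longrightarrow> y $ i = 0) \<Longrightarrow> y = 0\<^sub>v n" by auto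
  have "kernel_dim A \<le> card I"
    by (rule kernel_dim_le_card[OF graph_matrix_carrier[OF assms(1,2)] I(1,3)])
  then show ?thesis using I(2) by simp
qed

end
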